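(* Let $y$ solve $$y''(t)+P(t)y(t-T(t))=0,\qquad t\ge 0,$$ where $P(t)\ge|p(t)|$ and $T(t)\ge\tau(t)$ for $t\ge 0$. Let $T_m=\operatorname{ess\,sup}\{T(t):t\ge 0\}$ and assume that for some $b>0$ $$y(t)>0,\ t\in[-T_m,b),\qquad\text{and}\qquad y'(t)\le 0,\ t\in[-T_m,0].$$ Let $z$ solve $$z''(t)+p(t)z(t-\tau(t))=0,\qquad t\in[0,+\infty),$$ and suppose that, with $\tau_m=\operatorname{ess\,sup}\{\tau(t):t\ge 0\}$, $$|z(t)|\le y(t),\ t\in[-\tau_m,0],\qquad |z(b)|=y(b).$$ Then $$|z(t)|\le y(t),\qquad t\in[0,b].$$
   Context: $p,P$ are real-valued and $\tau,T$ are $[0,+\infty)$-valued functions, all Lebesgue measurable and essentially bounded. A solution of $x''(t)+p(t)x(t-\tau(t))=0$ on $[0,+\infty)$ is a function $x:[-\tau_m,+\infty)\to\mathbb{R}$, absolutely continuous together with its first derivative, satisfying the equation a.e. on $[0,+\infty)$; similarly for the equation with $P,T$, with $T_m$ in place of $\tau_m$. *)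

theory Defs
  imports "HOL-Analysis.Analysis" "HOL-Probability.Essential_Supremum"
begin

(* The half-line [0, infinity) carries Lebesgue measure on the completed sigma-algebra.
   All real functions are total in HOL; their values outside the stated domain play no role. *)
abbreviation half_line :: "real measure" where
  "half_line \<equiv> lebesgue_on {0..}"

definition essentially_bounded :: "(real \<Rightarrow> real) \<Rightarrow> bool" where
  "essentially_bounded f \<longleftrightarrow> esssup half_line (\<lambda>t. ereal \<bar>f t\<bar>) < \<infinity>"

(* esssup needs a complete linear order, hence the detour through ereal; for a
   measurable, essentially bounded f the value is finite and nothing is lost. *)
definition ess_sup :: "(real \<Rightarrow> real) \<Rightarrow> real" where
  "ess_sup f = real_of_ereal (esssup half_line (\<lambda>t. ereal (f t)))"

definition coefficient :: "(real \<Rightarrow> real) \<Rightarrow> bool" where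
  "coefficient p \<longleftrightarrow> p \<in> borel_measurable half_line \<and> essentially_bounded p"

definition delay :: "(real \<Rightarrow> real) \<Rightarrow> bool" where
  "delay \<tau> \<longleftrightarrow> \<tau> \<in> borel_measurable half_line \<and> essentially_bounded \<tau> \<and> (\<forall>t\<ge>0. 0 \<le> \<tau> t)"

(* The members of D are finitely many non-overlapping compact intervals K = [Inf K, Sup K]. *)
definition absolutely_continuous_fun_on :: "real set \<Rightarrow> (real \<Rightarrow> real) \<Rightarrow> bool" where
  "absolutely_continuous_fun_on S f \<longleftrightarrow>
     (\<forall>\<epsilon>>0. \<exists>\<delta>>0. \<forall>D. D division_of \<Union>D \<and> \<Union>D \<subseteq> S \<and> (\<Sum>K\<in>D. measure lborel K) < \<delta> \<longrightarrow>
        (\<Sum>K\<in>D. \<bar>f (Sup K) - f (Inf K)\<bar>) < \<epsilon>)"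

(* On an unbounded interval absolute continuity means absolute continuity on every
   compact subinterval. *)
definition locally_absolutely_continuous_on :: "real set \<Rightarrow> (real \<Rightarrow> real) \<Rightarrow> bool" where
  "locally_absolutely_continuous_on S f \<longleftrightarrow>
     (\<forall>a b. {a..b} \<subseteq> S \<longrightarrow> absolutely_continuous_fun_on {a..b} f)"

(* The first derivative on the solution interval [-ess_sup \<tau>, infinity); it is one-sided at
   the left endpoint. *)
definition sol_deriv :: "(real \<Rightarrow> real) \<Rightarrow> (real \<Rightarrow> real) \<Rightarrow> real \<Rightarrow> real" where
  "sol_deriv \<tau> x t = vector_derivative x (at t within {- ess_sup \<tau>..})"

(* x is a solution of x''(t) + p(t) x(t - \<tau>(t)) = 0 on [0, infinity); the second derivative is
   required to exist almost everywhere only. *)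
definition delay_solution :: "(real \<Rightarrow> real) \<Rightarrow> (real \<Rightarrow> real) \<Rightarrow> (real \<Rightarrow> real) \<Rightarrow> bool" where
  "delay_solution p \<tau> x \<longleftrightarrow>
     x differentiable_on {- ess_sup \<tau>..} \<and>
     locally_absolutely_continuous_on {- ess_sup \<tau>..} x \<and>
     locally_absolutely_continuous_on {- ess_sup \<tau>..} (sol_deriv \<tau> x) \<and>
     (AE t in half_line. \<exists>x2.
        (sol_deriv \<tau> x has_real_derivative x2) (at t within {- ess_sup \<tau>..}) \<and>
        x2 + p t * x (t - \<tau> t) = 0)"

end

(* Since y is positive, y'' <= 0 and y' <= 0 at 0, y is nonincreasing on [-T_m, b] and concave
   on [0, b]. If |z| <= M y for some M >= 1, then P >= |p| and T >= tau make M y - z and M y + z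
   concave on [0, b] as well, so they lie above their chords, hence above (M - 1) L with L the
   chord of y. As y <= K L for some K, the constant M improves to M - (M - 1) / K, and iterating
   drives it to 1. Comparing with the chord avoids distinguishing y(b) > 0 from y(b) = 0. *)
theory Submission
  imports Defs
begin

section \<open>Absolute continuity and monotonicity on compact intervals\<close>

lemma ac_fun_continuous_on:
  assumes "absolutely_continuous_fun_on {a..b} f"
  shows "continuous_on {a..b} f"
proof (subst continuous_on_iff, intro ballI allI impI)
  fix s e :: real
  assume s: "s \<in> {a..b}" and "e > 0"
  then obtain d where "d > 0"
    and d: "\<And>D. D division_of \<Union>D \<Longrightarrow> \<Union>D \<subseteq> {a..b} \<Longrightarrow> (\<Sum>K\<in>D. measure lborel K) < d
        \<Longrightarrow> (\<Sum>K\<in>D. \<bar>f (Sup K) - f (Inf K)\<bar>) < e"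
    using assms unfolding absolutely_continuous_fun_on_def by meson
  \<comment> \<open>The division consisting of the single interval \<open>{u..v}\<close> turns the
    defining estimate into uniform continuity.\<close>
  have le: "\<bar>f v - f u\<bar> < e" if "u \<in> {a..b}" "v \<in> {a..b}" "u \<le> v" "v - u < d" for u v
    using d[of "{{u..v}}"] that division_of_self[of u v] by auto
  show "\<exists>d>0. \<forall>x'\<in>{a..b}. dist x' s < d \<longrightarrow> dist (f x') (f s) < e"
  proof (intro exI[of _ d] conjI ballI impI)
    fix t assume "t \<in> {a..b}" "dist t s < d"
    then show "dist (f t) (f s) < e"
      using le[of s t] le[of t s] s by (cases "s \<le> t") (auto simp: dist_real_def)
  qed fact
qed

lemma ac_fun_lincomb:
  assumes f: "absolutely_continuous_fun_on S f" and g: "absolutely_continuous_fun_on S g"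
  shows "absolutely_continuous_fun_on S (\<lambda>t. c * f t + d * g t)"
  unfolding absolutely_continuous_fun_on_def
proof (intro allI impI)
  fix e :: real assume "e > 0"
  \<comment> \<open>The summand 1 keeps the denominator positive when \<open>c\<close> and
    \<open>d\<close> both vanish, and later makes the final estimate strict.\<close>
  define e' where "e' = e / (\<bar>c\<bar> + \<bar>d\<bar> + 1)"
  have "e' > 0" unfolding e'_def using \<open>e > 0\<close> by (intro divide_pos_pos) auto
  obtain r1 where "r1 > 0"
    and r1: "\<And>D. D division_of \<Union>D \<Longrightarrow> \<Union>D \<subseteq> S \<Longrightarrow> (\<Sum>K\<in>D. measure lborel K) < r1
        \<Longrightarrow> (\<Sum>K\<in>D. \<bar>f (Sup K) - f (Inf K)\<bar>) < e'"
    using f \<open>e' > 0\<close> unfolding absolutely_continuous_fun_on_def by meson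
  obtain r2 where "r2 > 0"
    and r2: "\<And>D. D division_of \<Union>D \<Longrightarrow> \<Union>D \<subseteq> S \<Longrightarrow> (\<Sum>K\<in>D. measure lborel K) < r2
        \<Longrightarrow> (\<Sum>K\<in>D. \<bar>g (Sup K) - g (Inf K)\<bar>) < e'"
    using g \<open>e' > 0\<close> unfolding absolutely_continuous_fun_on_def by meson
  show "\<exists>\<delta>>0. \<forall>D. D division_of \<Union>D \<and> \<Union>D \<subseteq> S \<and> (\<Sum>K\<in>D. measure lborel K) < \<delta> \<longrightarrow>
        (\<Sum>K\<in>D. \<bar>(c * f (Sup K) + d * g (Sup K)) - (c * f (Inf K) + d * g (Inf K))\<bar>) < e"
  proof (intro exI[of _ "min r1 r2"] conjI allI impI)
    fix D assume D: "D division_of \<Union>D \<and> \<Union>D \<subseteq> S \<and> (\<Sum>K\<in>D. measure lborel K) < min r1 r2"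
    have "(\<Sum>K\<in>D. \<bar>(c * f (Sup K) + d * g (Sup K)) - (c * f (Inf K) + d * g (Inf K))\<bar>)
        \<le> (\<Sum>K\<in>D. \<bar>c\<bar> * \<bar>f (Sup K) - f (Inf K)\<bar> + \<bar>d\<bar> * \<bar>g (Sup K) - g (Inf K)\<bar>)"
      by (intro sum_mono, unfold abs_mult[symmetric] right_diff_distrib) linarith
    also have "\<dots> = \<bar>c\<bar> * (\<Sum>K\<in>D. \<bar>f (Sup K) - f (Inf K)\<bar>) + \<bar>d\<bar> * (\<Sum>K\<in>D. \<bar>g (Sup K) - g (Inf K)\<bar>)"
      by (simp add: sum.distrib sum_distrib_left)
    also have "\<dots> \<le> \<bar>c\<bar> * e' + \<bar>d\<bar> * e'"
      using r1[of D] r2[of D] D by (intro add_mono mult_left_mono) auto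
    also have "\<dots> < (\<bar>c\<bar> + \<bar>d\<bar> + 1) * e'" using \<open>e' > 0\<close> by (simp add: algebra_simps)
    also have "\<dots> = e" unfolding e'_def by (simp add: add_nonneg_eq_0_iff)
    finally show "(\<Sum>K\<in>D. \<bar>(c * f (Sup K) + d * g (Sup K)) - (c * f (Inf K) + d * g (Inf K))\<bar>) < e" .
  qed (use \<open>r1 > 0\<close> \<open>r2 > 0\<close> in auto)
qed

text \<open>Because \<open>t\<close> lies between \<open>u\<close> and \<open>v\<close>, the
  linearization errors on its two sides, \<open>e * (v - t)\<close> and \<open>e * (t - u)\<close>,
  add up to exactly \<open>e * (v - u)\<close>, while the linear part \<open>D * (v - u)\<close> is
  nonpositive.\<close>

lemma straddle_nonpos_derivative:
  assumes "(f has_real_derivative D) (at t within {a..b})" "D \<le> 0" "e > 0" "t \<in> {a..b}"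
  shows "\<exists>r>0. \<forall>u v. u \<in> {a..b} \<and> v \<in> {a..b} \<and> u \<in> ball t r \<and> v \<in> ball t r \<and> u \<le> t \<and> t \<le> v
           \<longrightarrow> f v - f u \<le> e * (v - u)"
proof -
  obtain r where "r > 0"
    and r: "\<And>s. s \<in> {a..b} \<Longrightarrow> \<bar>s - t\<bar> < r \<Longrightarrow> \<bar>f s - f t - D * (s - t)\<bar> \<le> e * \<bar>s - t\<bar>"
    using assms(1,3) unfolding has_field_derivative_def has_derivative_within_alt
    by (auto simp: mult.commute)
  show ?thesis
  proof (intro exI[of _ r] conjI allI impI)
    fix u v assume uv: "u \<in> {a..b} \<and> v \<in> {a..b} \<and> u \<in> ball t r \<and> v \<in> ball t r \<and> u \<le> t \<and> t \<le> v"
    have "\<bar>f v - f t - D * (v - t)\<bar> \<le> e * (v - t)" "\<bar>f u - f t - D * (u - t)\<bar> \<le> e * (t - u)"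
      using r[of v] r[of u] uv by (auto simp: dist_real_def)
    moreover have "D * (v - t) \<le> 0" "D * (u - t) \<ge> 0"
      using uv \<open>D \<le> 0\<close> by (auto simp: mult_nonpos_nonneg mult_nonpos_nonpos)
    ultimately show "f v - f u \<le> e * (v - u)" by (simp add: algebra_simps)
  qed fact
qed

text \<open>A division fine enough splits the increment of \<open>f\<close> into intervals tagged in the exceptional
  null set, which contribute little by absolute continuity, and intervals straddling a point with
  nonpositive derivative.\<close>

lemma ac_fun_nonincreasing:
  fixes f :: "real \<Rightarrow> real"
  assumes "a \<le> b" and ac: "absolutely_continuous_fun_on {a..b} f" and N: "negligible N"
    and der: "\<And>t. t \<in> {a..b} - N \<Longrightarrow> \<exists>D\<le>0. (f has_real_derivative D) (at t within {a..b})"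
  shows "f b \<le> f a"
proof (rule field_le_epsilon)
  fix e0 :: real assume "e0 > 0"
  define e where "e = e0 / (1 + (b - a))"
  have "e > 0" unfolding e_def using \<open>e0 > 0\<close> \<open>a \<le> b\<close> by (intro divide_pos_pos) auto
  obtain d where "d > 0"
    and d: "\<And>D. D division_of \<Union>D \<Longrightarrow> \<Union>D \<subseteq> {a..b} \<Longrightarrow> (\<Sum>K\<in>D. measure lborel K) < d
        \<Longrightarrow> (\<Sum>K\<in>D. \<bar>f (Sup K) - f (Inf K)\<bar>) < e"
    using ac \<open>e > 0\<close> unfolding absolutely_continuous_fun_on_def by meson
  have Nnull: "N \<in> null_sets lebesgue" using N negligible_iff_null_sets by blast
  \<comment> \<open>Outer regularity: the null set is covered by an open set of measure below the
    \<open>d\<close> of absolute continuity.\<close>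
  obtain U where U: "open U" "N \<subseteq> U" "U - N \<in> lmeasurable" "emeasure lebesgue (U - N) < ennreal d"
    using sets_lebesgue_outer_open[of N d] Nnull \<open>d > 0\<close> by auto
  have "U \<in> sets lebesgue" using U(1) by auto
  have "emeasure lebesgue U < ennreal d"
    using U(4) Nnull \<open>U \<in> sets lebesgue\<close> by (simp add: emeasure_Diff_null_set)
  then have Um: "U \<in> lmeasurable"
    using \<open>U \<in> sets lebesgue\<close> by (auto simp: fmeasurable_def intro: less_trans)
  then have Ud: "measure lebesgue U < d"
    using \<open>emeasure lebesgue U < ennreal d\<close> by (simp add: emeasure_eq_measure2 ennreal_less_iff)
  \<comment> \<open>The gauge: at an exceptional point the ball stays inside \<open>U\<close>, at
    any other point of the interval the straddle estimate holds on it, and outside the interval any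
    radius will do.\<close>
  have "\<exists>r>0. (t \<in> N \<longrightarrow> ball t r \<subseteq> U) \<and> (t \<in> {a..b} - N \<longrightarrow>
      (\<forall>u v. u \<in> {a..b} \<and> v \<in> {a..b} \<and> u \<in> ball t r \<and> v \<in> ball t r \<and> u \<le> t \<and> t \<le> v
           \<longrightarrow> f v - f u \<le> e * (v - u)))" for t
  proof (cases "t \<in> N")
    case True
    then show ?thesis using U(1,2) open_contains_ball by blast
  next
    case False
    show ?thesis
    proof (cases "t \<in> {a..b}")
      case True
      then obtain D where "D \<le> 0" "(f has_real_derivative D) (at t within {a..b})"
        using der False by blast
      from straddle_nonpos_derivative[OF this(2,1) \<open>e > 0\<close> True] False show ?thesis by blast
    qed (use False zero_less_one in blast)
  qed
  then obtain r where r: "\<And>t. r t > 0" "\<And>t. t \<in> N \<Longrightarrow> ball t (r t) \<subseteq> U"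
    and straddle: "\<And>t u v. t \<in> {a..b} - N \<Longrightarrow> u \<in> {a..b} \<Longrightarrow> v \<in> {a..b} \<Longrightarrow> u \<in> ball t (r t)
        \<Longrightarrow> v \<in> ball t (r t) \<Longrightarrow> u \<le> t \<Longrightarrow> t \<le> v \<Longrightarrow> f v - f u \<le> e * (v - u)"
    by metis
  have "gauge (\<lambda>t. ball t (r t))" using r(1) by (simp add: gauge_ball_dependent)
  then obtain p where p: "p tagged_division_of {a..b}" "(\<lambda>t. ball t (r t)) fine p"
    by (rule fine_division_exists_real)
  note fin = tagged_division_of_finite[OF p(1)]
  have K: "\<exists>u v. K = {u..v} \<and> u \<le> x \<and> x \<le> v \<and> {u..v} \<subseteq> {a..b} \<and> {u..v} \<subseteq> ball x (r x)"
    if xK: "(x, K) \<in> p" for x K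
  proof -
    obtain u v where "K = {u..v}" using tagged_division_ofD(4)[OF p(1) xK] by (auto simp: cbox_interval)
    then show ?thesis
      using tagged_division_ofD(2,3)[OF p(1) xK] fineD[OF p(2) xK] by auto
  qed
  \<comment> \<open>The pieces tagged in \<open>N\<close> lie in \<open>U\<close>, so their total
    length is below \<open>d\<close> and absolute continuity bounds their contribution by
    \<open>e\<close>.\<close>
  define Q where "Q = {(x, K) \<in> p. x \<in> N}"
  have "Q \<subseteq> p" by (auto simp: Q_def)
  have Qp: "Q tagged_partial_division_of {a..b}"
    using tagged_partial_division_subset[OF _ \<open>Q \<subseteq> p\<close>] p(1) by (simp add: tagged_division_of_def)
  have div: "snd ` Q division_of \<Union>(snd ` Q)"
    using partial_division_of_tagged_division[OF Qp] .
  have sub: "\<Union>(snd ` Q) \<subseteq> {a..b}" "\<Union>(snd ` Q) \<subseteq> U"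
  proof -
    have "k \<subseteq> {a..b} \<and> k \<subseteq> U" if "(x, k) \<in> Q" for x k
      using K[of x k] r(2)[of x] that unfolding Q_def by blast
    then show "\<Union>(snd ` Q) \<subseteq> {a..b}" "\<Union>(snd ` Q) \<subseteq> U"
      by (simp_all add: UN_subset_iff split_paired_all)
  qed
  have "(\<Sum>k\<in>snd ` Q. measure lebesgue k) = measure lebesgue (\<Union>(snd ` Q))"
    using content_division[OF div] .
  also have "\<dots> \<le> measure lebesgue U"
    using sub(2) Um lmeasurable_division[OF div] by (intro measure_mono_fmeasurable) auto
  also have "\<dots> < d" by (fact Ud)
  also have "(\<Sum>k\<in>snd ` Q. measure lebesgue k) = (\<Sum>k\<in>snd ` Q. measure lborel k)"
  proof (rule sum.cong[OF refl])
    fix k assume "k \<in> snd ` Q"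
    then obtain u v where "k = cbox u v" using division_ofD(4)[OF div] by blast
    then show "measure lebesgue k = measure lborel k" by simp
  qed
  finally have "(\<Sum>k\<in>snd ` Q. measure lborel k) < d" .
  then have small: "(\<Sum>k\<in>snd ` Q. \<bar>f (Sup k) - f (Inf k)\<bar>) < e"
    using d[OF div sub(1)] by simp
  \<comment> \<open>Passing from a sum over tagged pieces to one over their underlying sets requires
    a summand that vanishes on every interval with empty interior. Singletons give 0 anyway; the
    empty set, whose \<open>Sup\<close> and \<open>Inf\<close> are unspecified, is sent to 0
    explicitly.\<close>
  define h where "h k = (if k = {} then 0 else \<bar>f (Sup k) - f (Inf k)\<bar>)" for k
  have h_eq: "h k = \<bar>f (Sup k) - f (Inf k)\<bar>" if "(x, k) \<in> p" for x k
    using K[OF that] by (auto simp: h_def)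
  have "(\<Sum>(x, k)\<in>Q. \<bar>f (Sup k) - f (Inf k)\<bar>) = (\<Sum>(x, k)\<in>Q. h k)"
    using h_eq \<open>Q \<subseteq> p\<close> by (intro sum.cong) auto
  also have "\<dots> = (\<Sum>k\<in>snd ` Q. h k)"
  proof (rule sum.over_tagged_division_lemma[OF tagged_partial_division_of_Union_self[OF Qp]])
    fix u v :: real assume "box u v = {}"
    then show "h (cbox u v) = 0" by (cases "u = v") (auto simp: h_def)
  qed
  also have "\<dots> = (\<Sum>k\<in>snd ` Q. \<bar>f (Sup k) - f (Inf k)\<bar>)"
    using h_eq \<open>Q \<subseteq> p\<close> by (intro sum.cong) auto
  finally have Qsum: "(\<Sum>(x, k)\<in>Q. f (Sup k) - f (Inf k)) \<le> e"
    using small sum_mono[of Q "\<lambda>(x, k). f (Sup k) - f (Inf k)" "\<lambda>(x, k). \<bar>f (Sup k) - f (Inf k)\<bar>"]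
    by fastforce
  have len: "f (Sup k) - f (Inf k) \<le> e * (Sup k - Inf k)" if xk: "(x, k) \<in> p - Q" for x k
  proof -
    obtain u v where uv: "k = {u..v}" "u \<le> x" "x \<le> v" "{u..v} \<subseteq> {a..b}" "{u..v} \<subseteq> ball x (r x)"
      using K[of x k] xk by blast
    moreover have "x \<notin> N" using xk by (auto simp: Q_def)
    moreover have "x \<in> {a..b}" "u \<in> {a..b}" "v \<in> {a..b}" "u \<in> ball x (r x)" "v \<in> ball x (r x)"
      using uv by (auto simp del: mem_ball)
    ultimately show ?thesis using straddle[of x u v] by auto
  qed
  have "(\<Sum>(x, k)\<in>p - Q. f (Sup k) - f (Inf k)) \<le> (\<Sum>(x, k)\<in>p - Q. e * (Sup k - Inf k))"
    using len by (intro sum_mono) auto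
  \<comment> \<open>Adding back the nonnegative terms of \<open>Q\<close> completes the division, so
    that the lengths telescope to \<open>b - a\<close>.\<close>
  also have "\<dots> \<le> (\<Sum>(x, k)\<in>p. e * (Sup k - Inf k))"
  proof (rule sum_mono2[OF fin])
    fix i assume "i \<in> p - (p - Q)"
    then show "0 \<le> (case i of (x, k) \<Rightarrow> e * (Sup k - Inf k))"
      using K[of "fst i" "snd i"] \<open>e > 0\<close> by (cases i) auto
  qed auto
  also have "\<dots> = e * (b - a)"
    using additive_tagged_division_1[OF \<open>a \<le> b\<close> p(1), of "\<lambda>t. e * t"] by (simp add: right_diff_distrib)
  finally have Rsum: "(\<Sum>(x, k)\<in>p - Q. f (Sup k) - f (Inf k)) \<le> e * (b - a)" .
  have "f b - f a = (\<Sum>(x, k)\<in>p. f (Sup k) - f (Inf k))"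
    using additive_tagged_division_1[OF \<open>a \<le> b\<close> p(1), of f] by simp
  also have "\<dots> = (\<Sum>(x, k)\<in>p - Q. f (Sup k) - f (Inf k)) + (\<Sum>(x, k)\<in>Q. f (Sup k) - f (Inf k))"
    using sum.subset_diff[OF \<open>Q \<subseteq> p\<close> fin] .
  also have "\<dots> \<le> e * (1 + (b - a))" using Qsum Rsum by (simp add: algebra_simps)
  also have "\<dots> = e0" unfolding e_def using \<open>a \<le> b\<close> by simp
  finally show "f b \<le> f a + e0" by simp
qed

text \<open>A nonincreasing derivative means concavity: the mean slope to the left of
  \<open>t\<close> is at least the one to the right. Clearing denominators lets the endpoints and
  \<open>a = b\<close> fit the same formula.\<close>

lemma chord_le_of_deriv_nonincreasing:
  fixes f f' :: "real \<Rightarrow> real"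
  assumes der: "\<And>t. t \<in> {a..b} \<Longrightarrow> (f has_real_derivative f' t) (at t within {a..b})"
    and mono: "\<And>s t. a \<le> s \<Longrightarrow> s \<le> t \<Longrightarrow> t \<le> b \<Longrightarrow> f' t \<le> f' s"
    and t: "t \<in> {a..b}"
  shows "f a * (b - t) + f b * (t - a) \<le> f t * (b - a)"
proof (cases "a < t \<and> t < b")
  case True
  have mvt: "\<exists>x\<in>{c<..<d}. f d - f c = f' x * (d - c)" if "a \<le> c" "c < d" "d \<le> b" for c d
    using that
    by (intro mvt_simple) (auto intro!: has_derivative_subset[OF der[unfolded has_field_derivative_def]])
  obtain x1 where x1: "x1 \<in> {a<..<t}" "f t - f a = f' x1 * (t - a)" using mvt[of a t] True by auto
  obtain x2 where x2: "x2 \<in> {t<..<b}" "f b - f t = f' x2 * (b - t)" using mvt[of t b] True by auto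
  have "f' x2 * ((b - t) * (t - a)) \<le> f' x1 * ((b - t) * (t - a))"
    using True x1 x2 by (intro mult_right_mono mono) auto
  then have "(f b - f t) * (t - a) \<le> (f t - f a) * (b - t)" unfolding x1 x2 by (simp add: algebra_simps)
  then show ?thesis by (simp add: algebra_simps)
next
  case False
  then have "t = a \<or> t = b" using t by auto
  then show ?thesis by auto
qed

section \<open>Essential suprema of delays and regularity of solutions\<close>

lemma delay_ess_sup:
  assumes "delay \<tau>"
  shows "0 \<le> ess_sup \<tau>" and "AE t in half_line. \<tau> t \<le> ess_sup \<tau>"
proof -
  let ?s = "esssup half_line (\<lambda>t. ereal (\<tau> t))"
  have pos: "AE t in half_line. 0 \<le> \<tau> t" 
    by (rule AE_I2) (use assms in \<open>simp add: delay_def\<close>)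
  have le: "AE t in half_line. ereal (\<tau> t) \<le> ?s" by (rule esssup_AE)
  \<comment> \<open>The half-line is not a null set, so a constant statement that holds almost
    everywhere is true. This carries the sign of \<open>\<tau>\<close> over to its essential
    supremum.\<close>
  have "emeasure half_line {0..1} = emeasure lebesgue {0..1::real}" by (subst emeasure_restrict_space) auto
  then have "emeasure half_line {0..1} \<noteq> 0" by simp
  moreover have "emeasure half_line {0..1} \<le> emeasure half_line (space half_line)" by (rule emeasure_space)
  ultimately have "emeasure half_line (space half_line) \<noteq> 0" by auto
  then have nontrivial: "ae_filter half_line \<noteq> bot" by (simp add: ae_filter_eq_bot_iff)
  have "AE t in half_line. 0 \<le> ?s" using pos le by eventually_elim (metis ereal_less_eq(5) order_trans)
  then have s0: "0 \<le> ?s" using nontrivial by (simp add: eventually_const)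
  have "?s = esssup half_line (\<lambda>t. ereal \<bar>\<tau> t\<bar>)"
  proof (rule esssup_AE_cong)
    have [measurable]: "\<tau> \<in> borel_measurable half_line" using assms by (simp add: delay_def)
    show "(\<lambda>t. ereal (\<tau> t)) \<in> borel_measurable half_line"
      and "(\<lambda>t. ereal \<bar>\<tau> t\<bar>) \<in> borel_measurable half_line"
      by measurable
    show "AE t in half_line. ereal (\<tau> t) = ereal \<bar>\<tau> t\<bar>" using pos by eventually_elim simp
  qed
  then have "?s < \<infinity>" using assms by (auto simp: delay_def essentially_bounded_def)
  \<comment> \<open>\<open>real_of_ereal\<close> sends infinite values to 0, so both bounds on
    \<open>?s\<close> are required before it can be identified with
    \<open>ess_sup \<tau>\<close>.\<close>
  then have s: "?s = ereal (ess_sup \<tau>)" using s0 by (simp add: ess_sup_def ereal_real)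
  show "0 \<le> ess_sup \<tau>" using s0 s by simp
  show "AE t in half_line. \<tau> t \<le> ess_sup \<tau>" using le s by simp
qed

lemma AE_half_line_negligible:
  assumes "AE t in half_line. Q t"
  shows "\<exists>N. negligible N \<and> (\<forall>t\<ge>0. t \<notin> N \<longrightarrow> Q t)"
proof -
  have "AE t in lebesgue. t \<in> {0..} \<longrightarrow> Q t" using assms by (subst (asm) AE_restrict_space_iff) auto
  then obtain N where "N \<in> null_sets lebesgue" "{t. \<not> (t \<in> {0..} \<longrightarrow> Q t)} \<subseteq> N"
    by (auto simp: eventually_ae_filter)
  then show ?thesis by (intro exI[of _ N]) (auto simp: negligible_iff_null_sets)
qed

lemma delay_solution_has_derivative:
  assumes "delay_solution p \<tau> x" "S \<subseteq> {- ess_sup \<tau>..}" "t \<in> S"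
  shows "(x has_real_derivative sol_deriv \<tau> x t) (at t within S)"
proof -
  have "x differentiable (at t within {- ess_sup \<tau>..})"
    using assms by (auto simp: delay_solution_def differentiable_on_def)
  then have "(x has_vector_derivative sol_deriv \<tau> x t) (at t within {- ess_sup \<tau>..})"
    unfolding sol_deriv_def vector_derivative_works .
  then show ?thesis
    using assms(2) by (auto simp: has_real_derivative_iff_has_vector_derivative
        intro: has_vector_derivative_within_subset)
qed

lemma delay_solution_deriv_ac:
  assumes "delay_solution p \<tau> x" "{a..b} \<subseteq> {- ess_sup \<tau>..}"
  shows "absolutely_continuous_fun_on {a..b} (sol_deriv \<tau> x)"
  using assms unfolding delay_solution_def locally_absolutely_continuous_on_def by blast

text \<open>Gathers the points where the equation fails or the delay exceeds its essential supremum
  into one negligible set, and restricts the derivative to intervals in the half-line, as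
  \<open>ac_fun_nonincreasing\<close> expects.\<close>

lemma delay_solution_second_derivative:
  assumes x: "delay_solution p \<tau> x" and \<tau>: "delay \<tau>"
  obtains N where "negligible N"
    and "\<And>a b t. t \<in> {a..b} - N \<Longrightarrow> a \<ge> 0
      \<Longrightarrow> (sol_deriv \<tau> x has_real_derivative - (p t * x (t - \<tau> t))) (at t within {a..b})"
    and "\<And>t. t \<ge> 0 \<Longrightarrow> t \<notin> N \<Longrightarrow> \<tau> t \<le> ess_sup \<tau>"
proof -
  have "AE t in half_line. (\<exists>x2. (sol_deriv \<tau> x has_real_derivative x2) (at t within {- ess_sup \<tau>..}) \<and>
      x2 + p t * x (t - \<tau> t) = 0) \<and> \<tau> t \<le> ess_sup \<tau>"
    using x delay_ess_sup(2)[OF \<tau>] unfolding delay_solution_def by (intro AE_conjI) auto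
  then obtain N where N: "negligible N"
    "\<And>t. t \<ge> 0 \<Longrightarrow> t \<notin> N \<Longrightarrow> (\<exists>x2. (sol_deriv \<tau> x has_real_derivative x2) (at t within {- ess_sup \<tau>..}) \<and>
      x2 + p t * x (t - \<tau> t) = 0) \<and> \<tau> t \<le> ess_sup \<tau>"
    using AE_half_line_negligible by blast
  show thesis
  proof (rule that[of N])
    fix a b t :: real assume t: "t \<in> {a..b} - N" "a \<ge> 0"
    then obtain x2 where "(sol_deriv \<tau> x has_real_derivative x2) (at t within {- ess_sup \<tau>..})"
      "x2 + p t * x (t - \<tau> t) = 0"
      using N(2)[of t] by auto
    moreover have "{a..b} \<subseteq> {- ess_sup \<tau>..}" using t delay_ess_sup(1)[OF \<tau>] by auto
    ultimately show "(sol_deriv \<tau> x has_real_derivative - (p t * x (t - \<tau> t))) (at t within {a..b})"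
      by (metis DERIV_subset eq_neg_iff_add_eq_0)
  qed (use N in auto)
qed

text \<open>The bound is anchored at the right endpoint so that it can be compared with a chord even
  when that chord vanishes there.\<close>

lemma abs_le_of_continuous_deriv:
  fixes f f' :: "real \<Rightarrow> real"
  assumes der: "\<And>t. t \<in> {a..b} \<Longrightarrow> (f has_real_derivative f' t) (at t within {a..b})"
    and cont: "continuous_on {a..b} f'"
  obtains C where "C \<ge> 0" "\<And>t. t \<in> {a..b} \<Longrightarrow> \<bar>f t\<bar> \<le> \<bar>f b\<bar> + C * (b - t)"
proof -
  have "bounded (f' ` {a..b})" using cont by (intro compact_imp_bounded compact_continuous_image) auto
  then obtain C where C: "C > 0" "\<And>t. t \<in> {a..b} \<Longrightarrow> \<bar>f' t\<bar> \<le> C"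
    unfolding bounded_pos by auto
  show thesis
  proof (rule that[of C])
    fix t assume t: "t \<in> {a..b}"
    have "norm (f b - f t) \<le> C * norm (b - t)"
      using t C(2) by (intro field_differentiable_bound[of "{a..b}" f f']) (auto intro: der)
    then show "\<bar>f t\<bar> \<le> \<bar>f b\<bar> + C * (b - t)" using t by simp
  qed (use C in simp)
qed

section \<open>Comparison of the two solutions\<close>

theorem theorem6:
  fixes p P \<tau> T y z :: "real \<Rightarrow> real" and b :: real
  assumes "coefficient p" and "coefficient P"
    and "delay \<tau>" and "delay T"
    and "delay_solution P T y"
    and "\<And>t. t \<ge> 0 \<Longrightarrow> P t \<ge> \<bar>p t\<bar>"
    and "\<And>t. t \<ge> 0 \<Longrightarrow> T t \<ge> \<tau> t"
    and "b > 0"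
    and "\<And>t. t \<in> {- ess_sup T..<b} \<Longrightarrow> y t > 0"
    and "\<And>t. t \<in> {- ess_sup T..0} \<Longrightarrow> sol_deriv T y t \<le> 0"
    and "delay_solution p \<tau> z"
    and "\<And>t. t \<in> {- ess_sup \<tau>..0} \<Longrightarrow> \<bar>z t\<bar> \<le> y t"
    and "\<bar>z b\<bar> = y b"
  shows "\<forall>t\<in>{0..b}. \<bar>z t\<bar> \<le> y t"
proof -
  note y = \<open>delay_solution P T y\<close> and z = \<open>delay_solution p \<tau> z\<close> and b = \<open>b > 0\<close>
  note Pp = assms(6) and T\<tau> = assms(7) and zy = assms(12)
  have Tm: "0 \<le> ess_sup T" and \<tau>m: "0 \<le> ess_sup \<tau>" using assms delay_ess_sup by auto
  have \<tau>0: "0 \<le> \<tau> t" if "t \<ge> 0" for t using \<open>delay \<tau>\<close> that by (simp add: delay_def)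
  define Y where "Y = sol_deriv T y"
  define Z where "Z = sol_deriv \<tau> z"
  obtain N1 where N1: "negligible N1"
    "\<And>a b t. t \<in> {a..b} - N1 \<Longrightarrow> a \<ge> 0
      \<Longrightarrow> (Y has_real_derivative - (P t * y (t - T t))) (at t within {a..b})"
    "\<And>t. t \<ge> 0 \<Longrightarrow> t \<notin> N1 \<Longrightarrow> T t \<le> ess_sup T"
    using delay_solution_second_derivative[OF y \<open>delay T\<close>] unfolding Y_def by blast
  obtain N2 where N2: "negligible N2"
    "\<And>a b t. t \<in> {a..b} - N2 \<Longrightarrow> a \<ge> 0
      \<Longrightarrow> (Z has_real_derivative - (p t * z (t - \<tau> t))) (at t within {a..b})"
    "\<And>t. t \<ge> 0 \<Longrightarrow> t \<notin> N2 \<Longrightarrow> \<tau> t \<le> ess_sup \<tau>"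
    using delay_solution_second_derivative[OF z \<open>delay \<tau>\<close>] unfolding Z_def by blast
  define N where "N = N1 \<union> N2"
  have N: "negligible N" using N1(1) N2(1) by (simp add: N_def)
  have dy: "(y has_real_derivative Y t) (at t within {s..b})" if "- ess_sup T \<le> s" "t \<in> {s..b}" for s t
    unfolding Y_def by (rule delay_solution_has_derivative[OF y]) (use that in auto)
  have dz: "(z has_real_derivative Z t) (at t within {0..b})" if "t \<in> {0..b}" for t
    unfolding Z_def by (rule delay_solution_has_derivative[OF z]) (use that \<tau>m in auto)
  have acY: "absolutely_continuous_fun_on {s..t} Y" if "0 \<le> s" for s t
    unfolding Y_def by (rule delay_solution_deriv_ac[OF y]) (use that Tm in auto)
  have acZ: "absolutely_continuous_fun_on {s..t} Z" if "0 \<le> s" for s t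
    unfolding Z_def by (rule delay_solution_deriv_ac[OF z]) (use that \<tau>m in auto)
  \<comment> \<open>The bracket in \<open>sgn\<close> is minus the second derivative of
    \<open>c * y + d * z\<close> almost everywhere. The choice (1, 0) serves \<open>y\<close> alone,
    and (M, 1) and (M, -1) serve the comparison with \<open>z\<close>.\<close>
  have deriv_mono: "c * Y t + d * Z t \<le> c * Y s + d * Z s"
    if "0 \<le> s" "s \<le> t" "t \<le> b"
      and sgn: "\<And>r. r \<in> {0..b} - N \<Longrightarrow> 0 \<le> c * (P r * y (r - T r)) + d * (p r * z (r - \<tau> r))" for c d s t
  proof (rule ac_fun_nonincreasing[OF \<open>s \<le> t\<close> _ N])
    show "absolutely_continuous_fun_on {s..t} (\<lambda>t. c * Y t + d * Z t)"
      using acY acZ \<open>0 \<le> s\<close> by (intro ac_fun_lincomb)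
    fix r assume r: "r \<in> {s..t} - N"
    have "((\<lambda>t. c * Y t + d * Z t) has_real_derivative
        c * - (P r * y (r - T r)) + d * - (p r * z (r - \<tau> r))) (at r within {s..t})"
      using r \<open>0 \<le> s\<close> by (intro DERIV_add DERIV_cmult N1(2) N2(2)) (auto simp: N_def)
    moreover have "0 \<le> c * (P r * y (r - T r)) + d * (p r * z (r - \<tau> r))"
      by (rule sgn) (use r that(1-3) in auto)
    then have "c * - (P r * y (r - T r)) + d * - (p r * z (r - \<tau> r)) \<le> 0" by simp
    ultimately show "\<exists>D\<le>0. ((\<lambda>t. c * Y t + d * Z t) has_real_derivative D) (at r within {s..t})"
      by blast
  qed
  have chord: "(c * y 0 + d * z 0) * (b - t) + (c * y b + d * z b) * t \<le> (c * y t + d * z t) * b"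
    if "t \<in> {0..b}"
      and sgn: "\<And>r. r \<in> {0..b} - N \<Longrightarrow> 0 \<le> c * (P r * y (r - T r)) + d * (p r * z (r - \<tau> r))" for c d t
  proof -
    have "((\<lambda>t. c * y t + d * z t) has_real_derivative c * Y r + d * Z r) (at r within {0..b})"
      if "r \<in> {0..b}" for r
      using that Tm by (intro DERIV_add DERIV_cmult dy dz) auto
    from chord_le_of_deriv_nonincreasing[OF this deriv_mono[OF _ _ _ sgn] \<open>t \<in> {0..b}\<close>]
    show ?thesis by simp
  qed
  \<comment> \<open>Positivity is assumed only to the left of \<open>b\<close>; at \<open>b\<close>
    itself the sign comes from \<open>y b = \<bar>z b\<bar>\<close>.\<close>
  have ynn: "0 \<le> y t" if "- ess_sup T \<le> t" "t \<le> b" for t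
    using that assms(9)[of t] \<open>\<bar>z b\<bar> = y b\<close> by (cases "t = b") auto
  \<comment> \<open>The pointwise order of the delays puts \<open>r - \<tau> r\<close> into the
    domain of \<open>y\<close>, without any comparison of \<open>ess_sup \<tau>\<close> with
    \<open>ess_sup T\<close>.\<close>
  have dom: "- ess_sup T \<le> r - T r" "r - T r \<le> r - \<tau> r" "- ess_sup \<tau> \<le> r - \<tau> r" "r - \<tau> r \<le> b"
    "0 \<le> P r" if "r \<in> {0..b} - N" for r
    using that N1(3)[of r] N2(3)[of r] T\<tau>[of r] \<tau>0[of r] Pp[of r] by (auto simp: N_def)
  have ysgn: "0 \<le> P r * y (r - T r)" if "r \<in> {0..b} - N" for r
    using dom[OF that] ynn by (intro mult_nonneg_nonneg) auto
  have Ynp: "Y t \<le> 0" if "- ess_sup T \<le> t" "t \<le> b" for t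
  proof (cases "t \<le> 0")
    case True
    then show ?thesis using that assms(10) by (simp add: Y_def)
  next
    case False
    then have "Y t \<le> Y 0" using deriv_mono[of 0 t 1 0] ysgn that by simp
    also have "Y 0 \<le> 0" using assms(10) Tm by (simp add: Y_def)
    finally show ?thesis .
  qed
  have ymono: "y t \<le> y s" if "- ess_sup T \<le> s" "s \<le> t" "t \<le> b" for s t
  proof -
    have "(y has_real_derivative Y x) (at x within {s..t})" if "s \<le> x" "x \<le> t" for x
      by (rule DERIV_subset[OF dy[of s x]])
        (use that \<open>- ess_sup T \<le> s\<close> \<open>t \<le> b\<close> in auto)
    then obtain x where "x \<in> {s..t}" "y t - y s = Y x * (t - s)"
      using mvt_very_simple[OF \<open>s \<le> t\<close>, of y "\<lambda>x h. Y x * h"]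
      unfolding has_field_derivative_def by blast
    moreover from this have "Y x * (t - s) \<le> 0"
      using that by (intro mult_nonpos_nonneg Ynp) auto
    ultimately show ?thesis by simp
  qed
  \<comment> \<open>This is \<open>b\<close> times the chord of \<open>y\<close> over
    \<open>{0..b}\<close>.\<close>
  define L where "L t = y 0 * (b - t) + y b * t" for t
  have y0: "y 0 > 0" using assms(9)[of 0] Tm b by simp
  have L_le: "L t \<le> b * y t" if "t \<in> {0..b}" for t
    using chord[OF that, of 1 0] ysgn by (simp add: L_def mult.commute)
  obtain C1 where C1: "C1 \<ge> 0" "\<And>t. t \<in> {0..b} \<Longrightarrow> \<bar>y t\<bar> \<le> \<bar>y b\<bar> + C1 * (b - t)"
    using abs_le_of_continuous_deriv[of 0 b y Y] dy[of 0] Tm ac_fun_continuous_on[OF acY, of 0 b] by auto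
  obtain C2 where C2: "C2 \<ge> 0" "\<And>t. t \<in> {0..b} \<Longrightarrow> \<bar>z t\<bar> \<le> \<bar>z b\<bar> + C2 * (b - t)"
    using abs_le_of_continuous_deriv[of 0 b z Z] dz ac_fun_continuous_on[OF acZ, of 0 b] by auto
  \<comment> \<open>Since \<open>y b \<le> y 0\<close>, \<open>L t\<close> dominates both
    \<open>b * y b\<close> and \<open>y 0 * (b - t)\<close>. The summand 1 pays for the first and
    the quotient for the linear term; \<open>C1 + C2\<close> covers \<open>y\<close> and
    \<open>z\<close> with one constant.\<close>
  define K where "K = 1 + b * (C1 + C2) / y 0"
  have K1: "K \<ge> 1" using C1(1) C2(1) b y0 by (simp add: K_def)
  have K_bound: "b * w \<le> K * L t" if t: "t \<in> {0..b}" and w: "w \<le> y b + (C1 + C2) * (b - t)" for w t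
  proof -
    have yb: "0 \<le> y b" "y b \<le> y 0" using ynn[of b] ymono[of 0 b] Tm b by auto
    have "y b * (b - t) \<le> y 0 * (b - t)" using yb t by (intro mult_right_mono) auto
    then have 1: "b * y b \<le> L t" by (simp add: L_def algebra_simps)
    have "y 0 * (b - t) \<le> L t" using yb t by (simp add: L_def)
    then have "(b * (C1 + C2) / y 0) * (y 0 * (b - t)) \<le> (b * (C1 + C2) / y 0) * L t"
      using C1(1) C2(1) b y0 by (intro mult_left_mono) auto
    then have 2: "b * ((C1 + C2) * (b - t)) \<le> (b * (C1 + C2) / y 0) * L t" using y0 by simp
    have "b * w \<le> b * (y b + (C1 + C2) * (b - t))" using w b by simp
    also have "\<dots> \<le> K * L t" using 1 2 by (simp add: K_def algebra_simps)
    finally show ?thesis .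
  qed
  have y_le: "b * y t \<le> K * L t" and z_le: "b * \<bar>z t\<bar> \<le> K * L t" if "t \<in> {0..b}" for t
  proof -
    have "0 \<le> C1 * (b - t)" "0 \<le> C2 * (b - t)" "0 \<le> y b" using that C1(1) C2(1) ynn[of b] Tm b by auto
    then show "b * y t \<le> K * L t" "b * \<bar>z t\<bar> \<le> K * L t"
      using C1(2)[OF that] C2(2)[OF that] \<open>\<bar>z b\<bar> = y b\<close> K_bound[OF that] by (auto simp: distrib_right)
  qed
  \<comment> \<open>One round of the iteration: the excess \<open>M - 1\<close> shrinks by the
    factor \<open>1 - 1 / K\<close>, which does not depend on \<open>M\<close>.\<close>
  have improve: "\<bar>z t\<bar> \<le> (1 + (1 - 1 / K) * (M - 1)) * y t"
    if M: "M \<ge> 1" "\<And>t. t \<in> {0..b} \<Longrightarrow> \<bar>z t\<bar> \<le> M * y t" and t: "t \<in> {0..b}" for M t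
  proof -
    have sgn: "0 \<le> M * (P r * y (r - T r)) + d * (p r * z (r - \<tau> r))"
      if r: "r \<in> {0..b} - N" and d: "\<bar>d\<bar> = 1" for r d
    proof -
      have "\<bar>z (r - \<tau> r)\<bar> \<le> M * y (r - \<tau> r)"
      \<comment> \<open>In the initial interval the bound by \<open>y\<close> is given and is
        weakened using \<open>M \<ge> 1\<close>; beyond it the bound \<open>M * y\<close> is the
        current one.\<close>
      proof (cases "r - \<tau> r \<le> 0")
        case True
        then have *: "\<bar>z (r - \<tau> r)\<bar> \<le> y (r - \<tau> r)" using zy dom[OF r] by auto
        also have "\<dots> \<le> M * y (r - \<tau> r)" using M(1) * mult_right_mono[of 1 M "y (r - \<tau> r)"] by simp
        finally show ?thesis .
      qed (use M(2) dom[OF r] in auto)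
      \<comment> \<open>The longer delay looks further back, where the nonincreasing
        \<open>y\<close> is at least as large.\<close>
      also have "\<dots> \<le> M * y (r - T r)" using ymono dom[OF r] M(1) by (intro mult_left_mono) auto
      finally have "\<bar>p r\<bar> * \<bar>z (r - \<tau> r)\<bar> \<le> P r * (M * y (r - T r))"
        using Pp[of r] r dom[OF r] by (intro mult_mono) auto
      then have "\<bar>d * (p r * z (r - \<tau> r))\<bar> \<le> M * (P r * y (r - T r))"
        using d by (simp add: abs_mult ac_simps)
      then show ?thesis by linarith
    qed
    \<comment> \<open>The sign \<open>d\<close> handles \<open>z\<close> and \<open>- z\<close>
      together.\<close>
    have "d * z t \<le> (1 + (1 - 1 / K) * (M - 1)) * y t" if d: "\<bar>d\<bar> = 1" for d
    proof -
      have zend: "d * z 0 \<le> y 0" "d * z b \<le> y b"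
        using zy[of 0] \<tau>m \<open>\<bar>z b\<bar> = y b\<close> d abs_ge_self[of "d * z 0"] abs_ge_self[of "d * z b"]
        by (auto simp: abs_mult)
      have "b * y t * ((M - 1) / K) \<le> K * L t * ((M - 1) / K)"
        using y_le[OF t] M(1) K1 by (intro mult_right_mono) auto
      also have "\<dots> = (M - 1) * L t" using K1 by simp
      also have "\<dots> = ((M - 1) * y 0) * (b - t) + ((M - 1) * y b) * t"
        by (simp add: L_def algebra_simps)
      \<comment> \<open>At both endpoints \<open>d * z\<close> is at most \<open>y\<close>, so
        \<open>M * y - d * z\<close> exceeds \<open>(M - 1) * y\<close> there; concavity then
        carries the chord bound to \<open>t\<close>.\<close>
      also have "\<dots> \<le> (M * y 0 + (- d) * z 0) * (b - t) + (M * y b + (- d) * z b) * t"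
        using zend t by (intro add_mono mult_right_mono) (auto simp: algebra_simps)
      also have "\<dots> \<le> (M * y t + (- d) * z t) * b"
        using d by (intro chord t sgn) auto
      finally have "b * y t * ((M - 1) / K) \<le> (M * y t + (- d) * z t) * b" .
      then have "b * (d * z t) \<le> b * ((1 + (1 - 1 / K) * (M - 1)) * y t)"
        by (simp add: algebra_simps diff_divide_distrib)
      then show ?thesis using b by (simp only: mult_le_cancel_left_pos)
    qed
    from this[of 1] this[of "-1"] show ?thesis by (auto simp: abs_le_iff)
  qed
  define q where "q = 1 - 1 / K"
  have q: "0 \<le> q" "q < 1" using K1 by (auto simp: q_def)
  \<comment> \<open>The start is \<open>M = K\<close>: \<open>\<bar>z\<bar>\<close> is bounded by
    \<open>K / b\<close> times \<open>L\<close>, and \<open>L\<close> by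
    \<open>b * y\<close>.\<close>
  have iterate: "\<forall>t\<in>{0..b}. \<bar>z t\<bar> \<le> (1 + q ^ n * (K - 1)) * y t" for n
  proof (induction n)
    case 0
    show ?case
    proof
      fix t assume t: "t \<in> {0..b}"
      have "K * L t \<le> K * (b * y t)" using K1 L_le[OF t] by (intro mult_left_mono) auto
      then have "b * \<bar>z t\<bar> \<le> b * (K * y t)" using z_le[OF t] by (simp add: ac_simps)
      then show "\<bar>z t\<bar> \<le> (1 + q ^ 0 * (K - 1)) * y t" using b by simp
    qed
  next
    case (Suc n)
    have "1 \<le> 1 + q ^ n * (K - 1)" using q K1 by simp
    from improve[OF this] Suc show ?case by (simp add: q_def mult.assoc)
  qed
  show ?thesis
  proof
    fix t assume "t \<in> {0..b}"
    have "(\<lambda>n. (1 + q ^ n * (K - 1)) * y t) \<longlonglongrightarrow> (1 + 0 * (K - 1)) * y t"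
      using q by (intro tendsto_intros LIMSEQ_power_zero) auto
    then show "\<bar>z t\<bar> \<le> y t"
      using iterate \<open>t \<in> {0..b}\<close> by (intro LIMSEQ_le_const[of _ "y t"]) auto
  qed
qed

end
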